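(* $$\frac{\sin(4\pi/13)\sin(6\pi/13)}{\sin(2\pi/13)\sin(3\pi/13)}-\frac{\sin(2\pi/13)\sin(3\pi/13)}{\sin(\pi/13)\sin(5\pi/13)}-\frac{\sin(5\pi/13)\sin(\pi/13)}{\sin(4\pi/13)\sin(6\pi/13)}=1.$$ *)

theory Defs
  imports Complex_Main
begin

end

theory Submission
  imports Defs
begin

text \<open>
  Put \<open>d k = 2 cos (2k\<pi>/13)\<close>. By the product-to-sum formula the three products of sines are
  \<open>(d 1 - d 5)/4\<close>, \<open>(d 4 - d 6)/4\<close> and \<open>(d 2 - d 3)/4\<close>. Each \<open>d k\<close> is a polynomial in \<open>x = d 1\<close>,
  and \<open>x\<close> is a root of the sextic obtained by dividing \<open>d 7 - d 6 = 0\<close> by \<open>x - 2\<close>. After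
  clearing denominators the claim is a polynomial consequence of the sextic equation.
\<close>

text \<open>The Chebyshev recurrence: in the sum of \<open>cos ((n+1)*t + t)\<close> and
  \<open>cos ((n+1)*t - t)\<close> the sine terms cancel.\<close>

lemma two_cos_Suc_Suc:
  fixes t :: real
  shows "2 * cos (real (Suc (Suc n)) * t) =
    (2 * cos t) * (2 * cos (real (Suc n) * t)) - 2 * cos (real n * t)"
proof -
  have "cos (real (Suc (Suc n)) * t) = cos (real (Suc n) * t + t)"
    and "cos (real n * t) = cos (real (Suc n) * t - t)"
    by (simp_all add: algebra_simps)
  then show ?thesis
    by (simp add: cos_add cos_diff)
qed

text \<open>The factor 2 rescales the Chebyshev polynomials to monic ones with integer
  coefficients.\<close>

lemma two_cos_multiple_angle:
  fixes t :: real
  defines "x \<equiv> 2 * cos t"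
  shows "2 * cos (2 * t) = x^2 - 2"
    and "2 * cos (3 * t) = x^3 - 3*x"
    and "2 * cos (4 * t) = x^4 - 4*x^2 + 2"
    and "2 * cos (5 * t) = x^5 - 5*x^3 + 5*x"
    and "2 * cos (6 * t) = x^6 - 6*x^4 + 9*x^2 - 2"
    and "2 * cos (7 * t) = x^7 - 7*x^5 + 14*x^3 - 7*x"
proof -
  note step = two_cos_Suc_Suc[of _ t, folded x_def]
  have 1: "2 * cos t = x"
    by (simp add: x_def)
  show 2: "2 * cos (2 * t) = x^2 - 2"
    using step[of 0] by (simp add: x_def power2_eq_square)
  have "2 * cos (3 * t) = x * (2 * cos (2 * t)) - 2 * cos t"
    using step[of 1] by simp
  then show 3: "2 * cos (3 * t) = x^3 - 3*x"
    unfolding 1 2 by algebra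
  have "2 * cos (4 * t) = x * (2 * cos (3 * t)) - 2 * cos (2 * t)"
    using step[of 2] by simp
  then show 4: "2 * cos (4 * t) = x^4 - 4*x^2 + 2"
    unfolding 2 3 by algebra
  have "2 * cos (5 * t) = x * (2 * cos (4 * t)) - 2 * cos (3 * t)"
    using step[of 3] by simp
  then show 5: "2 * cos (5 * t) = x^5 - 5*x^3 + 5*x"
    unfolding 3 4 by algebra
  have "2 * cos (6 * t) = x * (2 * cos (5 * t)) - 2 * cos (4 * t)"
    using step[of 4] by simp
  then show 6: "2 * cos (6 * t) = x^6 - 6*x^4 + 9*x^2 - 2"
    unfolding 4 5 by algebra
  have "2 * cos (7 * t) = x * (2 * cos (6 * t)) - 2 * cos (5 * t)"
    using step[of 5] by simp
  then show "2 * cos (7 * t) = x^7 - 7*x^5 + 14*x^3 - 7*x"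
    unfolding 5 6 by algebra
qed

text \<open>For t = 2\<pi>/13 one has 7t = 2\<pi> - 6t, so 7t and 6t have the same cosine. The angle
  0 shares this property and accounts for the extra root 2.\<close>

lemma two_cos_2pi_div_13_root:
  fixes x :: real
  defines "x \<equiv> 2 * cos (2 * pi / 13)"
  shows "x^6 + x^5 - 5*x^4 - 4*x^3 + 6*x^2 + 3*x - 1 = 0"
proof -
  have "cos (7 * (2 * pi / 13)) = cos (2 * pi - 6 * (2 * pi / 13))"
    by (rule arg_cong[of _ _ cos]) simp
  also have "\<dots> = cos (6 * (2 * pi / 13))"
    by (rule cos_2pi_minus)
  finally have "x^7 - 7*x^5 + 14*x^3 - 7*x = x^6 - 6*x^4 + 9*x^2 - 2"
    using two_cos_multiple_angle(5,6)[of "2 * pi / 13"] unfolding x_def by linarith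
  then have "(x - 2) * (x^6 + x^5 - 5*x^4 - 4*x^3 + 6*x^2 + 3*x - 1) = 0"
    by algebra
  \<comment> \<open>This gives x < 2, so the factor \<open>x - 2\<close> can be cancelled.\<close>
  moreover have "cos (2 * pi / 13) < cos 0"
    by (intro cos_monotone_0_pi) (use pi_gt_zero in auto)
  ultimately show ?thesis
    unfolding x_def by simp
qed

theorem theorem4p5:
  "sin (4 * pi / 13) * sin (6 * pi / 13) / (sin (2 * pi / 13) * sin (3 * pi / 13))
    - sin (2 * pi / 13) * sin (3 * pi / 13) / (sin (pi / 13) * sin (5 * pi / 13))
    - sin (5 * pi / 13) * sin (pi / 13) / (sin (4 * pi / 13) * sin (6 * pi / 13)) = (1::real)"
proof -
  define t where "t = 2 * pi / 13"
  define x where "x = 2 * cos t"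
  define A where "A = sin (4 * pi / 13) * sin (6 * pi / 13)"
  define B where "B = sin (2 * pi / 13) * sin (3 * pi / 13)"
  define C where "C = sin (pi / 13) * sin (5 * pi / 13)"
  note d = two_cos_multiple_angle[of t, folded x_def]
  have pos: "A > 0" "B > 0" "C > 0"
    unfolding A_def B_def C_def by (intro mult_pos_pos sin_gt_zero; use pi_gt_zero in simp)+
  have "4 * A = 2 * cos t - 2 * cos (5 * t)"
    by (simp add: A_def t_def sin_times_sin flip: diff_divide_distrib add_divide_distrib)
  then have A: "4 * A = x - (x^5 - 5*x^3 + 5*x)"
    using d x_def by linarith
  \<comment> \<open>Odd multiples of \<pi>/13 become multiples of \<open>t\<close> by reflection:
    \<pi> - \<pi>/13 = 6t and \<pi> - 5\<pi>/13 = 4t.\<close>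
  have "cos (pi / 13) = - cos (6 * t)" "cos (5 * pi / 13) = - cos (4 * t)"
    unfolding cos_pi_minus[symmetric] by (simp_all add: t_def field_simps)
  moreover have "4 * B = 2 * cos (pi / 13) - 2 * cos (5 * pi / 13)"
    by (simp add: B_def sin_times_sin flip: diff_divide_distrib add_divide_distrib)
  ultimately have B: "4 * B = (x^4 - 4*x^2 + 2) - (x^6 - 6*x^4 + 9*x^2 - 2)"
    using d by linarith
  have "4 * C = 2 * cos (2 * t) - 2 * cos (3 * t)"
    by (simp add: C_def t_def sin_times_sin flip: diff_divide_distrib add_divide_distrib)
  then have C: "4 * C = (x^2 - 2) - (x^3 - 3*x)"
    using d by linarith
  have "x^6 + x^5 - 5*x^4 - 4*x^3 + 6*x^2 + 3*x - 1 = 0"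
    using two_cos_2pi_div_13_root by (simp add: x_def t_def)
  \<comment> \<open>The goal times \<open>A * B * C\<close> is homogeneous of degree 3, so the
    scaling by 4 is harmless. In terms of \<open>x\<close>, the difference of the two sides is a
    multiple of the sextic.\<close>
  then have "(4*A)^2 * (4*C) - (4*B)^2 * (4*A) - (4*C)^2 * (4*B) = (4*A) * (4*B) * (4*C)"
    unfolding A B C by algebra
  then have "A^2 * C - B^2 * A - C^2 * B = A * B * C"
    by (simp add: power_mult_distrib)
  then have "A / B - B / C - C / A = 1"
    using pos by (simp add: field_simps power2_eq_square)
  then show ?thesis
    by (simp add: A_def B_def C_def mult.commute)
qed

end
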